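(* For $\lambda>0$ let $n\ell_{2,\lambda}$ be the probability that the first player loses the $2$-jump normal game started at the root of the Galton-Watson tree with Poisson$(\lambda)$ offspring distribution. Then $\lim_{\lambda\to\infty}\lambda^i\,n\ell_{2,\lambda}=0$ for all $i\in\mathbb{N}$.
   Context: In the Galton-Watson tree every vertex independently has a Poisson$(\lambda)$ number of children. In the $2$-jump normal game a token starts at a vertex; two players alternate, a move relocating the token from its current vertex to any child or grandchild of it. A player unable to move loses. The whole tree is known to both players and both play optimally; a game that goes on forever is a draw. $\mathbb{N}=\{1,2,\dots\}$. *)

theory Defs
  imports "HOL-Probability.Probability"
begin

text \<open>A two-player normal game on positions of type \<open>'p\<close>: \<open>mv p\<close> is the set of positions that can be
  reached from \<open>p\<close> in one move. In a play \<open>p 0, p 1, \<dots>\<close> the first player moves at even indices and the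
  second player at odd ones. A strategy of the second player maps the nonempty history of all positions
  visited so far (the current one last) to the next position.\<close>

definition legal_strategy :: "('p \<Rightarrow> 'p set) \<Rightarrow> ('p list \<Rightarrow> 'p) \<Rightarrow> bool" where
  "legal_strategy mv \<tau> \<longleftrightarrow>
     (\<forall>h. h \<noteq> [] \<longrightarrow> mv (last h) \<noteq> {} \<longrightarrow> \<tau> h \<in> mv (last h))"

text \<open>Complete finite plays from \<open>v\<close> in which the second player follows \<open>\<tau>\<close>; the last position is one
  at which the player to move is stuck.\<close>

definition finite_play :: "('p \<Rightarrow> 'p set) \<Rightarrow> ('p list \<Rightarrow> 'p) \<Rightarrow> 'p \<Rightarrow> 'p list \<Rightarrow> bool" where
  "finite_play mv \<tau> v ps \<longleftrightarrow>
     ps \<noteq> [] \<and> hd ps = v \<and> mv (last ps) = {} \<and>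
     (\<forall>n. Suc n < length ps \<longrightarrow> ps ! Suc n \<in> mv (ps ! n)) \<and>
     (\<forall>n. Suc n < length ps \<longrightarrow> odd n \<longrightarrow> ps ! Suc n = \<tau> (take (Suc n) ps))"

definition infinite_play :: "('p \<Rightarrow> 'p set) \<Rightarrow> ('p list \<Rightarrow> 'p) \<Rightarrow> 'p \<Rightarrow> (nat \<Rightarrow> 'p) \<Rightarrow> bool" where
  "infinite_play mv \<tau> v p \<longleftrightarrow>
     p 0 = v \<and> (\<forall>n. p (Suc n) \<in> mv (p n)) \<and>
     (\<forall>n. odd n \<longrightarrow> p (Suc n) = \<tau> (map p [0..<Suc n]))"

text \<open>The first player loses under optimal play iff the second player has a winning strategy: it admits
  no infinite play (a draw), and every complete finite play ends with the first player stuck, i.e. its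
  last index \<open>length ps - 1\<close> is even.\<close>

definition first_player_loses :: "('p \<Rightarrow> 'p set) \<Rightarrow> 'p \<Rightarrow> bool" where
  "first_player_loses mv v \<longleftrightarrow>
     (\<exists>\<tau>. legal_strategy mv \<tau> \<and>
          (\<forall>ps. finite_play mv \<tau> v ps \<longrightarrow> odd (length ps)) \<and>
          (\<nexists>p. infinite_play mv \<tau> v p))"

text \<open>Ulam--Harris encoding: vertices are finite words over the naturals, the root is \<open>[]\<close>, and
  \<open>\<omega> v\<close> is the number of children of \<open>v\<close>. Offspring numbers are also attached to words that are not
  vertices of the tree; these words cannot be reached from the root.\<close>

definition children :: "(nat list \<Rightarrow> nat) \<Rightarrow> nat list \<Rightarrow> nat list set" where
  "children \<omega> v = {v @ [i] | i. i < \<omega> v}"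

definition two_jump_moves :: "(nat list \<Rightarrow> nat) \<Rightarrow> nat list \<Rightarrow> nat list set" where
  "two_jump_moves \<omega> v = children \<omega> v \<union> (\<Union>u\<in>children \<omega> v. children \<omega> u)"

definition poisson_GW :: "real \<Rightarrow> (nat list \<Rightarrow> nat) measure" where
  "poisson_GW r = (\<Pi>\<^sub>M v\<in>UNIV. measure_pmf (poisson_pmf r))"

text \<open>The event below is measurable, so \<open>measure\<close> is its genuine probability: every \<open>two_jump_moves \<omega> v\<close>
  is finite, hence the event is a countable union over \<open>n\<close> of the events that the second player can
  force a win within \<open>n\<close> moves, each determined by countably many discrete coordinates in a
  measurable way. \<open>poisson_pmf r\<close> is specified for \<open>r > 0\<close> only.\<close>

definition nl2 :: "real \<Rightarrow> real" where
  "nl2 r = measure (poisson_GW r)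
     {\<omega> \<in> space (poisson_GW r). first_player_loses (two_jump_moves \<omega>) []}"

end

theory Submission
  imports Defs "HOL-Real_Asymp.Real_Asymp"
begin

text \<open>
  Write \<open>P\<^sub>k\<close> for the event that the second player can force a win from the root within \<open>k\<close> rounds,
  \<open>\<ell>\<^sub>k\<close> for its probability, and \<open>n\<^sub>k\<close> for the probability that some child or grandchild of the root is
  in \<open>P\<^sub>k\<close>, in the sense of its own subtree. Two estimates relate these numbers.

  If the root is in \<open>P\<^bsub>k+1\<^esub>\<close>, then each of its children, like every position that the first player can
  move to, has a child or grandchild in \<open>P\<^sub>k\<close>. The subtrees at the children are independent copies of
  the tree and their number is Poisson, so that
  \<open>\<ell>\<^bsub>k+1\<^esub> \<le> exp (- r * (1 - n\<^sub>k))\<close> (\<open>prob_all_children\<close>). Conversely the expected number of children and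
  grandchildren of the root is \<open>r + r\<^sup>2\<close>, so that \<open>n\<^sub>k \<le> (r + r\<^sup>2) * \<ell>\<^sub>k\<close> (\<open>prob_some_child_le\<close>).

  If \<open>\<ell>\<^sub>k \<le> exp (- r / 2)\<close>, then \<open>n\<^sub>k \<le> 1 / 2\<close> as soon as \<open>r\<close> is large, and the first estimate gives back
  \<open>\<ell>\<^bsub>k+1\<^esub> \<le> exp (- r / 2)\<close>. As \<open>\<ell>\<^sub>0 = 0\<close>, this bound holds for every \<open>k\<close>. The number of moves at
  each position is finite, so a second player who wins at all wins within a bounded number of rounds, and
  the bound passes to the union of the increasing events \<open>P\<^sub>k\<close>. Hence \<open>nl2 r\<close> even decays
  exponentially.

  The bound has to be carried along \<open>k\<close> and cannot be read off from the limit \<open>\<ell>\<close> of the \<open>\<ell>\<^sub>k\<close>. In a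
  tree without draws, \<open>\<ell>\<close> would be the probability that no child or grandchild of the root is lost for
  its mover, that is \<open>\<ell> = exp (- r * (\<ell> + 1 - exp (- r * \<ell>)))\<close>, and the solution of this equation is of
  order \<open>ln r / r\<^sup>2\<close>. So consistency of the limit alone does not exclude a polynomial decay; the start at
  \<open>\<ell>\<^sub>0 = 0\<close> does.
\<close>

section \<open>Losing within a bounded number of rounds\<close>

text \<open>A round is a move of the first player and a reply. Round \<open>Suc k\<close> also covers a first player who is
  stuck at \<open>v\<close>, since the universal quantifier is then vacuous.\<close>

fun loses_within :: "('p \<Rightarrow> 'p set) \<Rightarrow> nat \<Rightarrow> 'p \<Rightarrow> bool" where
  "loses_within mv 0 v \<longleftrightarrow> False"
| "loses_within mv (Suc k) v \<longleftrightarrow> (\<forall>w\<in>mv v. \<exists>x\<in>mv w. loses_within mv k x)"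

lemma loses_within_mono:
  assumes "loses_within mv k v" "k \<le> m"
  shows "loses_within mv m v"
  using assms
proof (induction k arbitrary: m v)
  case (Suc k)
  then obtain m' where "m = Suc m'" "k \<le> m'"
    by (cases m) auto
  with Suc show ?case by fastforce
qed simp

text \<open>This is the point where finite branching enters. If every move of the first player could be answered
  by a position that is lost within some number of rounds, the maximum of these finitely many numbers would
  bound the length of the game from \<open>v\<close>.\<close>

lemma safe_move_exists:
  assumes fin: "finite (mv v)" and v: "\<And>k. \<not> loses_within mv k v"
  shows "\<exists>w\<in>mv v. \<forall>x\<in>mv w. \<forall>k. \<not> loses_within mv k x"
proof (rule ccontr)
  assume "\<not> ?thesis"
  then obtain f where f: "\<And>w. w \<in> mv v \<Longrightarrow> \<exists>x\<in>mv w. loses_within mv (f w) x"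
    by metis
  define m where "m = Max (f ` mv v)"
  have "loses_within mv (Suc m) v"
  proof (simp, intro ballI)
    fix w assume w: "w \<in> mv v"
    then have "f w \<le> m" using fin by (simp add: m_def)
    with f[OF w] show "\<exists>x\<in>mv w. loses_within mv m x"
      using loses_within_mono by metis
  qed
  with v show False by blast
qed

text \<open>Otherwise the first player can defeat any strategy \<open>\<tau>\<close> of the second player by always choosing a
  move as in \<open>safe_move_exists\<close>: then no reply of the second player leads to a position that is lost within
  a bounded number of rounds. Such a play is infinite, or it ends with the second player stuck, because a
  position at which the first player is stuck is lost within one round.\<close>

lemma first_player_loses_imp_loses_within:
  assumes fin: "\<And>v. finite (mv v)" and lose: "first_player_loses mv v"
  shows "\<exists>k. loses_within mv k v"
proof (rule ccontr)
  assume v: "\<nexists>k. loses_within mv k v"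
  define safe where "safe x \<longleftrightarrow> (\<forall>k. \<not> loses_within mv k x)" for x
  from lose obtain \<tau> where legal: "legal_strategy mv \<tau>"
    and fin_play: "\<And>ps. finite_play mv \<tau> v ps \<Longrightarrow> odd (length ps)"
    and inf_play: "\<And>p. \<not> infinite_play mv \<tau> v p"
    unfolding first_player_loses_def by blast
  define nxt where "nxt h = (if odd (length h)
      then (SOME w. w \<in> mv (last h) \<and> (\<forall>x\<in>mv w. safe x)) else \<tau> h)" for h
  \<comment> \<open>\<open>H n\<close> is the history after \<open>n\<close> moves. Its length is \<open>Suc n\<close>, so the first player, who moves at even
    indices, is to move when the length is odd.\<close>
  define H where "H n = ((\<lambda>h. h @ [nxt h]) ^^ n) [v]" for n
  define p where "p n = last (H n)" for n
  have H_Suc: "H (Suc n) = H n @ [nxt (H n)]" for n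
    by (simp add: H_def)
  have H_eq: "H n = map p [0..<Suc n]" for n
  proof (induction n)
    case 0
    show ?case by (simp add: p_def H_def)
  next
    case (Suc n)
    have "H (Suc n) = H n @ [p (Suc n)]"
      by (simp add: p_def H_Suc)
    with Suc show ?case by simp
  qed
  have len: "length (H n) = Suc n" for n
    by (simp add: H_eq)
  have p_Suc: "p (Suc n) = nxt (H n)" for n
    by (simp add: p_def H_Suc)
  have p_0: "p 0 = v"
    by (simp add: p_def H_def)
  have reply: "p (Suc n) = \<tau> (H n)" if "odd n" for n
    using that by (simp add: p_Suc nxt_def len)
  have legal': "\<tau> (H n) \<in> mv (p n)" if "mv (p n) \<noteq> {}" for n
  proof -
    have "H n \<noteq> []" using len[of n] by auto
    with that legal show ?thesis unfolding legal_strategy_def p_def by blast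
  qed
  have first: "p (Suc n) \<in> mv (p n) \<and> (\<forall>x\<in>mv (p (Suc n)). safe x)"
    if "even n" "safe (p n)" for n
  proof -
    have "\<exists>w. w \<in> mv (p n) \<and> (\<forall>x\<in>mv w. safe x)"
      using safe_move_exists[where mv = mv and v = "p n", OF fin] that(2) unfolding safe_def by blast
    then show ?thesis
      using someI_ex[of "\<lambda>w. w \<in> mv (p n) \<and> (\<forall>x\<in>mv w. safe x)"] that(1)
      unfolding p_Suc nxt_def len p_def[symmetric] by simp
  qed
  \<comment> \<open>The invariant of the play, up to and including the first position without a move.\<close>
  have good: "(if even n then safe (p n) else \<forall>x\<in>mv (p n). safe x)"
    if "\<And>m. m < n \<Longrightarrow> mv (p m) \<noteq> {}" for n
    using that
  proof (induction n)
    case 0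
    show ?case using v by (simp add: p_0 safe_def)
  next
    case (Suc n)
    then have IH: "if even n then safe (p n) else \<forall>x\<in>mv (p n). safe x"
      by simp
    show ?case
    proof (cases "even n")
      case True
      with IH first[of n] show ?thesis by simp
    next
      case False
      with IH reply[of n] legal'[of n] Suc.prems[of n] show ?thesis by simp
    qed
  qed
  have step: "p (Suc n) \<in> mv (p n)" if "\<And>m. m \<le> n \<Longrightarrow> mv (p m) \<noteq> {}" for n
  proof (cases "even n")
    case True
    have "if even n then safe (p n) else \<forall>x\<in>mv (p n). safe x"
      using that by (intro good) (meson less_imp_le)
    with True first[of n] show ?thesis by simp
  next
    case False
    with reply[of n] legal'[OF that[OF order_refl]] show ?thesis by simp
  qed
  show False
  proof (cases "\<exists>n. mv (p n) = {}")
    case False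
    then have "infinite_play mv \<tau> v p"
      using step reply p_0 unfolding infinite_play_def H_eq by simp
    with inf_play show False by blast
  next
    case True
    define n where "n = (LEAST n. mv (p n) = {})"
    have stuck: "mv (p n) = {}"
      using True unfolding n_def by (rule LeastI_ex)
    have before: "mv (p m) \<noteq> {}" if "m < n" for m
      using that not_less_Least unfolding n_def by blast
    have "odd n"
    proof
      assume "even n"
      then have "safe (p n)"
        using good[of n, OF before] by simp
      then have "\<not> loses_within mv (Suc 0) (p n)"
        unfolding safe_def by blast
      with stuck show False by simp
    qed
    have "finite_play mv \<tau> v (H n)"
      unfolding finite_play_def
    proof (intro conjI allI impI)
      show "H n \<noteq> []" using len[of n] by auto
      show "hd (H n) = v" by (simp add: H_eq hd_map p_0 del: upt_Suc)
      show "mv (last (H n)) = {}" using stuck by (simp add: p_def)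
      fix m assume m: "Suc m < length (H n)"
      then have *: "H n ! Suc m = p (Suc m)" "H n ! m = p m" "take (Suc m) (H n) = H m"
        by (simp_all add: H_eq take_map take_upt nth_append del: upt_Suc)
      show "H n ! Suc m \<in> mv (H n ! m)"
        using m step[of m] before by (simp add: * len)
      show "H n ! Suc m = \<tau> (take (Suc m) (H n))" if "odd m"
        using reply[OF that] by (simp only: *)
    qed
    then have "odd (length (H n))" by (rule fin_play)
    with \<open>odd n\<close> show False by (simp add: len)
  qed
qed

section \<open>The game on the subtrees of the root\<close>

definition subtree :: "nat \<Rightarrow> (nat list \<Rightarrow> nat) \<Rightarrow> nat list \<Rightarrow> nat" where
  "subtree i \<omega> = (\<lambda>v. \<omega> (i # v))"

lemma children_Cons: "children \<omega> (i # v) = (#) i ` children (subtree i \<omega>) v"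
  by (auto simp: children_def subtree_def)

lemma two_jump_moves_Cons:
  "two_jump_moves \<omega> (i # v) = (#) i ` two_jump_moves (subtree i \<omega>) v"
  by (auto simp: two_jump_moves_def children_Cons)

lemma finite_two_jump_moves: "finite (two_jump_moves \<omega> v)"
proof -
  have "finite (children \<omega> v)" for v
    by (simp add: children_def)
  then show ?thesis by (simp add: two_jump_moves_def)
qed

text \<open>All moves lead down the tree, so that the game from a vertex below \<open>i\<close> takes place inside the subtree at
  \<open>i\<close>.\<close>

lemma loses_within_Cons:
  "loses_within (two_jump_moves \<omega>) k (i # v) \<longleftrightarrow> loses_within (two_jump_moves (subtree i \<omega>)) k v"
  by (induction k arbitrary: v) (auto simp: two_jump_moves_Cons)

text \<open>Events about the descendants of the root are composed from the next two operators. Grandchildren are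
  reached by applying an operator twice.\<close>

definition all_children :: "(nat list \<Rightarrow> nat) set \<Rightarrow> (nat list \<Rightarrow> nat) set" where
  "all_children S = {\<omega>. \<forall>i<\<omega> []. subtree i \<omega> \<in> S}"

definition some_child :: "(nat list \<Rightarrow> nat) set \<Rightarrow> (nat list \<Rightarrow> nat) set" where
  "some_child S = {\<omega>. \<exists>i<\<omega> []. subtree i \<omega> \<in> S}"

lemma some_child_eq: "some_child S = - all_children (- S)"
  by (auto simp: some_child_def all_children_def)

definition lost_trees :: "nat \<Rightarrow> (nat list \<Rightarrow> nat) set" where
  "lost_trees k = {\<omega>. loses_within (two_jump_moves \<omega>) k []}"

lemma bex_two_jump_moves_root:
  "(\<exists>x\<in>two_jump_moves \<omega> []. P x) \<longleftrightarrow>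
     (\<exists>i<\<omega> []. P [i] \<or> (\<exists>j<\<omega> [i]. P [i, j]))"
  by (fastforce simp: two_jump_moves_def children_def)

lemma some_move_loses:
  "(\<exists>x\<in>two_jump_moves \<omega> []. loses_within (two_jump_moves \<omega>) k x) \<longleftrightarrow>
     \<omega> \<in> some_child (lost_trees k) \<union> some_child (some_child (lost_trees k))"
  unfolding bex_two_jump_moves_root
  by (auto simp: loses_within_Cons some_child_def lost_trees_def) (auto simp: subtree_def)

text \<open>The moves from the root are its children and grandchildren, and the first player must lose whichever is
  chosen: all of these vertices lie in \<open>W\<close>, the event that a child or grandchild is lost for its mover. The
  form of the right-hand side makes \<open>lost_trees k\<close> measurable by induction on \<open>k\<close>.\<close>

lemma lost_trees_Suc:
  fixes k :: nat
  defines "W \<equiv> some_child (lost_trees k) \<union> some_child (some_child (lost_trees k))"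
  shows "lost_trees (Suc k) = all_children (W \<inter> all_children W)"
proof -
  \<comment> \<open>\<open>fold subtree v \<omega>\<close> is the subtree at the vertex \<open>v\<close>.\<close>
  have win: "(\<exists>x\<in>two_jump_moves \<omega> v. loses_within (two_jump_moves \<omega>) k x) \<longleftrightarrow>
      fold subtree v \<omega> \<in> W" for \<omega> v
  proof (induction v arbitrary: \<omega>)
    case Nil
    then show ?case by (simp add: some_move_loses W_def)
  next
    case (Cons i v)
    have "(\<exists>x\<in>two_jump_moves \<omega> (i # v). loses_within (two_jump_moves \<omega>) k x) \<longleftrightarrow>
      (\<exists>x\<in>two_jump_moves (subtree i \<omega>) v. loses_within (two_jump_moves (subtree i \<omega>)) k x)"
      by (simp add: two_jump_moves_Cons loses_within_Cons)
    with Cons show ?case by simp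
  qed
  have "\<omega> \<in> lost_trees (Suc k) \<longleftrightarrow> \<not> (\<exists>w\<in>two_jump_moves \<omega> []. fold subtree w \<omega> \<notin> W)" for \<omega>
    by (simp add: lost_trees_def win)
  then show ?thesis
    unfolding bex_two_jump_moves_root by (auto simp: all_children_def) (auto simp: subtree_def)
qed

lemma incseq_lost_trees: "incseq lost_trees"
  by (rule monoI) (auto simp: lost_trees_def intro: loses_within_mono)

section \<open>The branching property of the Poisson tree\<close>

locale poisson_tree =
  fixes r :: real
  assumes r_pos: "0 < r"
begin

abbreviation "GW \<equiv> poisson_GW r"

sublocale prob_space GW
  unfolding poisson_GW_def by (intro prob_space_PiM prob_space_measure_pmf)

lemma space_GW [simp]: "space GW = UNIV"
  by (simp add: poisson_GW_def space_PiM PiE_UNIV_domain)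

lemma measurable_coordinate [measurable]: "(\<lambda>\<omega>. \<omega> v) \<in> GW \<rightarrow>\<^sub>M count_space UNIV"
proof -
  have "(\<lambda>\<omega>. \<omega> v) \<in> GW \<rightarrow>\<^sub>M measure_pmf (poisson_pmf r)"
    unfolding poisson_GW_def by (rule measurable_component_singleton) simp
  then show ?thesis by simp
qed

lemma measurable_into_GW:
  assumes "\<And>v. (\<lambda>x. f x v) \<in> M \<rightarrow>\<^sub>M count_space UNIV"
  shows "f \<in> M \<rightarrow>\<^sub>M GW"
  unfolding poisson_GW_def
  using assms by (intro measurable_PiM_single') (auto simp: PiE_UNIV_domain)

lemma measurable_subtree [measurable]: "subtree i \<in> GW \<rightarrow>\<^sub>M GW"
  unfolding subtree_def by (rule measurable_into_GW) measurable

lemma distr_coordinate: "distr GW (measure_pmf (poisson_pmf r)) (\<lambda>\<omega>. \<omega> v) = measure_pmf (poisson_pmf r)"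
  unfolding poisson_GW_def
  by (rule distr_PiM_component) (auto intro: prob_space_measure_pmf)

lemma distr_subtree: "distr GW GW (subtree i) = GW"
  using distr_PiM_reindex[of UNIV "\<lambda>_. measure_pmf (poisson_pmf r)" "(#) i" UNIV]
  by (simp add: poisson_GW_def subtree_def[abs_def] prob_space_measure_pmf restrict_def)

lemma indep_coordinates: "indep_vars (\<lambda>_. measure_pmf (poisson_pmf r)) (\<lambda>v \<omega>. \<omega> v) UNIV"
proof (subst indep_vars_iff_distr_eq_PiM')
  have "distr GW (\<Pi>\<^sub>M v\<in>UNIV. measure_pmf (poisson_pmf r)) (\<lambda>\<omega>. \<lambda>v\<in>UNIV. \<omega> v) = GW"
    by (simp add: poisson_GW_def restrict_def distr_id2)
  then show "distr GW (\<Pi>\<^sub>M v\<in>UNIV. measure_pmf (poisson_pmf r)) (\<lambda>\<omega>. \<lambda>v\<in>UNIV. \<omega> v) =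
      (\<Pi>\<^sub>M v\<in>UNIV. distr GW (measure_pmf (poisson_pmf r)) (\<lambda>\<omega>. \<omega> v))"
    unfolding distr_coordinate by (simp add: poisson_GW_def)
qed simp_all

text \<open>The offspring number of the root and the subtrees at the children are functions of disjoint blocks of
  coordinates. For a family of random variables of one type, the offspring number is encoded as a
  constant tree.\<close>

lemma indep_root_subtrees:
  "indep_vars (\<lambda>_. GW) (\<lambda>j \<omega>. case j of None \<Rightarrow> (\<lambda>v. \<omega> []) | Some i \<Rightarrow> subtree i \<omega>) UNIV"
proof -
  define pos where "pos j v = (case j of None \<Rightarrow> [] | Some i \<Rightarrow> i # v)" for j :: "nat option" and v
  have disj: "disjoint_family_on (\<lambda>j. range (pos j)) UNIV"
    by (auto simp: disjoint_family_on_def pos_def split: option.splits)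
  have "indep_vars (\<lambda>_. GW) (\<lambda>j \<omega>. (\<lambda>v. restrict (\<lambda>v. \<omega> v) (range (pos j)) (pos j v))) UNIV"
  proof (rule indep_vars_compose2[OF indep_vars_restrict[OF indep_coordinates _ disj]])
    fix j
    have "(\<lambda>g. g (pos j v)) \<in> (\<Pi>\<^sub>M v\<in>range (pos j). measure_pmf (poisson_pmf r)) \<rightarrow>\<^sub>M
        measure_pmf (poisson_pmf r)" for v
      by (rule measurable_component_singleton) simp
    then show "(\<lambda>g v. g (pos j v)) \<in> (\<Pi>\<^sub>M v\<in>range (pos j). measure_pmf (poisson_pmf r)) \<rightarrow>\<^sub>M GW"
      by (intro measurable_into_GW) simp
  qed simp
  moreover have "(\<lambda>v. restrict (\<lambda>v. \<omega> v) (range (pos j)) (pos j v)) =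
      (case j of None \<Rightarrow> (\<lambda>v. \<omega> []) | Some i \<Rightarrow> subtree i \<omega>)" for j \<omega>
    by (auto simp: pos_def subtree_def split: option.splits)
  ultimately show ?thesis by simp
qed

lemma sets_all_children [measurable]:
  assumes [measurable]: "S \<in> sets GW"
  shows "all_children S \<in> sets GW"
proof -
  have "{\<omega>\<in>space GW. \<forall>i<\<omega> []. subtree i \<omega> \<in> S} \<in> sets GW"
    by measurable
  then show ?thesis by (simp add: all_children_def)
qed

lemma sets_some_child [measurable]:
  assumes "S \<in> sets GW"
  shows "some_child S \<in> sets GW"
proof -
  have "- S \<in> sets GW" 
    using sets.compl_sets[OF assms] by (simp add: Compl_eq_Diff_UNIV)
  then show ?thesis
    using sets.compl_sets[OF sets_all_children, of "- S"]
    by (simp add: some_child_eq Compl_eq_Diff_UNIV)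
qed

lemma prob_offspring_and_subtrees:
  assumes S: "S \<in> sets GW"
  shows "prob {\<omega>. \<omega> [] = n \<and> (\<forall>i<n. subtree i \<omega> \<in> S)} = pmf (poisson_pmf r) n * prob S ^ n"
proof -
  define Y where "Y j \<omega> = (case j of None \<Rightarrow> (\<lambda>v. \<omega> []) | Some i \<Rightarrow> subtree i \<omega>)"
    for j and \<omega> :: "nat list \<Rightarrow> nat"
  define A where "A j = (case j of None \<Rightarrow> {\<omega>. \<omega> [] = n} | Some i \<Rightarrow> S)" for j :: "nat option"
  define J where "J = insert None (Some ` {..<n})"
  have R: "{\<omega>. \<omega> [] = n} \<in> sets GW"
  proof -
    have "{\<omega>\<in>space GW. \<omega> [] = n} \<in> sets GW" by measurable
    then show ?thesis by simp
  qed
  have "prob (\<Inter>j\<in>J. Y j -` A j \<inter> space GW) = (\<Prod>j\<in>J. prob (Y j -` A j \<inter> space GW))"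
    unfolding Y_def
    by (rule indep_varsD[OF indep_root_subtrees]) (auto simp: J_def A_def S R split: option.split)
  moreover have "(\<Inter>j\<in>J. Y j -` A j \<inter> space GW) = {\<omega>. \<omega> [] = n \<and> (\<forall>i<n. subtree i \<omega> \<in> S)}"
    by (auto simp: J_def Y_def A_def)
  moreover have "prob (Y (Some i) -` A (Some i) \<inter> space GW) = prob S" for i
  proof -
    have "prob S = measure (distr GW GW (subtree i)) S" by (simp add: distr_subtree)
    also have "\<dots> = prob (subtree i -` S \<inter> space GW)"
      using S by (intro measure_distr) measurable
    finally show ?thesis by (simp add: Y_def A_def vimage_def)
  qed
  moreover have "prob (Y None -` A None \<inter> space GW) = pmf (poisson_pmf r) n"
  proof -
    have "pmf (poisson_pmf r) n = measure (distr GW (measure_pmf (poisson_pmf r)) (\<lambda>\<omega>. \<omega> [])) {n}"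
      by (simp add: distr_coordinate measure_pmf_single)
    also have "\<dots> = prob ((\<lambda>\<omega>. \<omega> []) -` {n} \<inter> space GW)"
      by (intro measure_distr) simp_all
    finally show ?thesis by (simp add: Y_def A_def vimage_def)
  qed
  ultimately show ?thesis
    by (simp add: J_def prod.reindex)
qed

text \<open>Conditionally on \<open>n\<close> children the event has probability \<open>prob S ^ n\<close>. So this is the probability
  generating function of the Poisson distribution, evaluated at \<open>prob S\<close>.\<close>

lemma prob_all_children:
  assumes S: "S \<in> sets GW"
  shows "prob (all_children S) = exp (- r * (1 - prob S))"
proof -
  define B where "B n = {\<omega>. \<omega> [] = n \<and> (\<forall>i<n. subtree i \<omega> \<in> S)}" for n
  have "{\<omega>\<in>space GW. \<omega> [] = n \<and> (\<forall>i<n. subtree i \<omega> \<in> S)} \<in> sets GW" for n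
    using S by measurable
  then have "range B \<subseteq> sets GW" by (auto simp: B_def)
  moreover have "disjoint_family B" by (auto simp: disjoint_family_on_def B_def)
  ultimately have "(\<lambda>n. prob (B n)) sums prob (\<Union>n. B n)"
    by (rule finite_measure_UNION)
  moreover have "(\<Union>n. B n) = all_children S"
    by (auto simp: B_def all_children_def)
  moreover have "prob (B n) = exp (- r) * ((r * prob S) ^ n /\<^sub>R fact n)" for n
    using r_pos by (simp add: B_def prob_offspring_and_subtrees[OF S] power_mult_distrib field_simps)
  moreover have "(\<lambda>n. exp (- r) * ((r * prob S) ^ n /\<^sub>R fact n)) sums (exp (- r) * exp (r * prob S))"
    by (intro sums_mult exp_converges)
  ultimately have "prob (all_children S) = exp (- r) * exp (r * prob S)"
    by (simp add: sums_iff)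
  then show ?thesis by (simp add: exp_add[symmetric] algebra_simps)
qed

text \<open>The right-hand side is the expected number of children whose subtree is in \<open>S\<close>. The proof bounds the exact
  value \<open>1 - exp (- r * prob S)\<close>.\<close>

lemma prob_some_child_le:
  assumes S: "S \<in> sets GW"
  shows "prob (some_child S) \<le> r * prob S"
proof -
  have "- S \<in> sets GW" "prob (- S) = 1 - prob S"
    using prob_compl[OF S] sets.compl_sets[OF S] by (simp_all add: Compl_eq_Diff_UNIV)
  then have "prob (all_children (- S)) = exp (- r * prob S)" "all_children (- S) \<in> sets GW"
    by (simp_all add: prob_all_children sets_all_children)
  then have "prob (some_child S) = 1 - exp (- r * prob S)"
    using prob_compl[of "all_children (- S)"] by (simp add: some_child_eq Compl_eq_Diff_UNIV)
  also have "\<dots> \<le> r * prob S"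
    using exp_ge_add_one_self[of "- r * prob S"] by simp
  finally show ?thesis .
qed

section \<open>Exponential decay of the losing probability\<close>

lemma sets_lost_trees [measurable]: "lost_trees k \<in> sets GW"
proof (induction k)
  case 0
  then show ?case by (simp add: lost_trees_def)
next
  case (Suc k)
  then show ?case unfolding lost_trees_Suc by measurable
qed

lemma prob_lost_trees_Suc_le:
  "prob (lost_trees (Suc k)) \<le> exp (- r * (1 - (r + r\<^sup>2) * prob (lost_trees k)))"
proof -
  define C where "C = some_child (lost_trees k)"
  define W where "W = C \<union> some_child C"
  have C [measurable]: "C \<in> sets GW" unfolding C_def by measurable
  have W [measurable]: "W \<in> sets GW" unfolding W_def by measurable
  have C_le: "prob C \<le> r * prob (lost_trees k)"
    unfolding C_def by (rule prob_some_child_le) measurable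
  have "prob W \<le> prob C + prob (some_child C)"
    unfolding W_def by (rule measure_Un_le) measurable
  also have "\<dots> \<le> prob C + r * prob C"
    by (intro add_left_mono prob_some_child_le C)
  also have "\<dots> = (1 + r) * prob C" by (simp add: algebra_simps)
  also have "\<dots> \<le> (1 + r) * (r * prob (lost_trees k))"
    using r_pos by (intro mult_left_mono C_le) simp
  finally have W_le: "prob W \<le> (r + r\<^sup>2) * prob (lost_trees k)"
    by (simp add: algebra_simps power2_eq_square)
  have "lost_trees (Suc k) \<subseteq> all_children W"
    unfolding lost_trees_Suc W_def C_def by (auto simp: all_children_def)
  then have "prob (lost_trees (Suc k)) \<le> prob (all_children W)"
    by (rule finite_measure_mono) measurable
  also have "\<dots> = exp (- r * (1 - prob W))"
    by (rule prob_all_children[OF W])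
  also have "\<dots> \<le> exp (- r * (1 - (r + r\<^sup>2) * prob (lost_trees k)))"
    using W_le r_pos by simp
  finally show ?thesis .
qed

text \<open>Under the hypothesis on \<open>r\<close>, the interval below \<open>exp (- r / 2)\<close> is invariant under the recursion of
  \<open>prob_lost_trees_Suc_le\<close>.\<close>

lemma prob_lost_trees_le:
  assumes r: "(r + r\<^sup>2) * exp (- r / 2) \<le> 1 / 2"
  shows "prob (lost_trees k) \<le> exp (- r / 2)"
proof (induction k)
  case 0
  then show ?case by (simp add: lost_trees_def)
next
  case (Suc k)
  have "(r + r\<^sup>2) * prob (lost_trees k) \<le> (r + r\<^sup>2) * exp (- r / 2)"
    using r_pos by (intro mult_left_mono Suc) simp
  with r have "(r + r\<^sup>2) * prob (lost_trees k) \<le> 1 / 2" by linarith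
  then have "r * (1 / 2) \<le> r * (1 - (r + r\<^sup>2) * prob (lost_trees k))"
    using r_pos by (intro mult_left_mono) auto
  then have "exp (- r * (1 - (r + r\<^sup>2) * prob (lost_trees k))) \<le> exp (- r / 2)"
    by simp
  with prob_lost_trees_Suc_le[of k] show ?case by linarith
qed

lemma nl2_le:
  assumes r: "(r + r\<^sup>2) * exp (- r / 2) \<le> 1 / 2"
  shows "nl2 r \<le> exp (- r / 2)"
proof -
  have "{\<omega> \<in> space GW. first_player_loses (two_jump_moves \<omega>) []} \<subseteq> (\<Union>k. lost_trees k)"
    using first_player_loses_imp_loses_within[OF finite_two_jump_moves]
    by (auto simp: lost_trees_def)
  then have "nl2 r \<le> prob (\<Union>k. lost_trees k)"
    unfolding nl2_def by (rule finite_measure_mono) measurable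
  moreover have "(\<lambda>k. prob (lost_trees k)) \<longlonglongrightarrow> prob (\<Union>k. lost_trees k)"
    by (rule finite_Lim_measure_incseq) (auto simp: incseq_lost_trees sets_lost_trees)
  then have "prob (\<Union>k. lost_trees k) \<le> exp (- r / 2)"
    by (rule LIMSEQ_le_const2) (use prob_lost_trees_le[OF r] in auto)
  ultimately show ?thesis by linarith
qed

end

theorem theorem1p6:
  shows "\<forall>i::nat. i \<ge> 1 \<longrightarrow> ((\<lambda>r::real. r ^ i * nl2 r) \<longlongrightarrow> 0) at_top"
proof (intro allI impI)
  fix i :: nat
  have "eventually (\<lambda>r::real. (r + r\<^sup>2) * exp (- r / 2) \<le> 1 / 2) at_top"
    by real_asymp
  then have "eventually (\<lambda>r. norm (r ^ i * nl2 r) \<le> r ^ i * exp (- r / 2)) at_top"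
    using eventually_gt_at_top[of 0]
  proof eventually_elim
    case (elim r)
    then interpret poisson_tree r by unfold_locales
    show ?case
      using nl2_le elim by (simp add: nl2_def abs_mult mult_left_mono)
  qed
  moreover have "((\<lambda>r::real. r ^ i * exp (- r / 2)) \<longlongrightarrow> 0) at_top"
    by real_asymp
  ultimately show "((\<lambda>r::real. r ^ i * nl2 r) \<longlongrightarrow> 0) at_top"
    by (rule Lim_null_comparison)
qed

end
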